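(* Let $H_{\mathrm{WR}}$ be the Widom–Rowlinson graph, i.e. the path on three vertices $r,w,b$ (with edges $rw$ and $wb$) with a loop at every vertex, equipped with positive vertex weights $\lambda_r,\lambda_w,\lambda_b$ on $r,w,b$ respectively. Then for every $d\geq 1$ and every $d$-regular simple graph $G$ on $n$ vertices, $$Z(G,H_{\mathrm{WR}})\leq Z(K_{d+1},H_{\mathrm{WR}})^{n/(d+1)}.$$
   Context: For a graph $G$ and a (possibly looped) graph $F$ with vertex weight function $\mu:V(F)\to\mathbb{R}_+$, the partition function is $$Z(G,F)=\sum_{\varphi:V(G)\to V(F)}\ \prod_{(u,v)\in E(G)}\mathbb{I}_{E(F)}(\varphi(u),\varphi(v))\prod_{w\in V(G)}\mu(\varphi(w)),$$ where $\mathbb{I}_{E(F)}$ is the indicator function of the edge set of $F$. $K_{d+1}$ is the complete graph on $d+1$ vertices. *)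

theory Defs
  imports Complex_Main "HOL-Library.FuncSet" "HOL-Library.Indicator_Function"
    "Graph_Theory.Graph_Theory"
begin

text \<open>
  Undirected graphs are symmetric digraphs, as in the locale \<^locale>\<open>graph\<close> (finite, no loops,
  no multiple arcs) and the locale \<^locale>\<open>pseudo_graph\<close> (loops allowed). An undirected edge
  \<open>uv\<close> with \<open>u \<noteq> v\<close> is the pair of arcs \<open>(u,v)\<close>, \<open>(v,u)\<close>, so the degree of a vertex is its
  out-degree.
\<close>

definition regular_graph :: "nat \<Rightarrow> ('a, 'b) pre_digraph \<Rightarrow> bool" where
  "regular_graph d G \<longleftrightarrow> graph G \<and> (\<forall>v\<in>verts G. out_degree G v = d)"

text \<open>
  The first product runs over arcs, so every edge of \<open>G\<close> contributes twice. As the arcs of \<open>F\<close> are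
  symmetric and the indicator is 0 or 1, this is the product over undirected edges.
\<close>

definition partition_function ::
    "('a, 'b) pre_digraph \<Rightarrow> ('c, 'e) pre_digraph \<Rightarrow> ('c \<Rightarrow> real) \<Rightarrow> real" where
  "partition_function G F \<mu> =
     (\<Sum>\<phi>\<in>verts G \<rightarrow>\<^sub>E verts F.
        (\<Prod>(u, v)\<in>arcs_ends G. indicator (arcs_ends F) (\<phi> u, \<phi> v)) *
        (\<Prod>w\<in>verts G. \<mu> (\<phi> w)))"

datatype wr_vertex = Red | White | Blue

definition WR_graph :: "(wr_vertex, wr_vertex \<times> wr_vertex) pre_digraph" where
  "WR_graph = with_proj
     \<lparr>pverts = {Red, White, Blue},
      parcs = {(Red, Red), (White, White), (Blue, Blue),
               (Red, White), (White, Red), (White, Blue), (Blue, White)}\<rparr>"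

fun WR_weight :: "real \<Rightarrow> real \<Rightarrow> real \<Rightarrow> wr_vertex \<Rightarrow> real" where
  "WR_weight lr lw lb Red = lr"
| "WR_weight lr lw lb White = lw"
| "WR_weight lr lw lb Blue = lb"

lemma pseudo_graph_WR_graph: "pseudo_graph WR_graph"
  unfolding WR_graph_def
  by unfold_locales (auto simp: symmetric_def arcs_ends_conv sym_def)

end

theory Submission
  imports Defs "HOL-Analysis.Convex"
begin

text \<open>
  Given the set \<open>B\<close> of blue vertices, each remaining vertex is white, or red if its closed
  neighbourhood misses \<open>B\<close>, independently of the others. Hence the partition function of \<open>G\<close> is
  \<open>\<lambda>\<^sub>w\<^sup>n\<close> times an integral, over a product of two-point spaces, of a product of functions \<open>f\<^sub>u\<close>, where
  \<open>f\<^sub>u\<close> depends only on the coordinates in the closed neighbourhood of \<open>u\<close>. Every vertex lies in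
  exactly \<open>d + 1\<close> closed neighbourhoods, so Finner's generalized Hoelder inequality bounds the
  integral by the product of the \<open>L\<^sup>d\<^sup>+\<^sup>1\<close> norms of the \<open>f\<^sub>u\<close>. All these norms agree, and as every
  closed neighbourhood in the complete graph is the whole vertex set, the \<open>(d + 1)\<close>-st power of
  the norm is the partition function of the complete graph divided by \<open>\<lambda>\<^sub>w\<^sup>d\<^sup>+\<^sup>1\<close>.
\<close>

section \<open>Hoelder's inequality on a two-point space\<close>

text \<open>The geometric mean \<open>y\<close> is given by its power, so that uses of the mean
  inequality involve no real exponents; as \<open>y\<close> is nonnegative, the root of that power
  is \<open>y\<close> again.\<close>

lemma geom_le_arith_mean:
  fixes x :: "'i \<Rightarrow> real"
  assumes "finite J" "J \<noteq> {}" "\<And>i. i \<in> J \<Longrightarrow> 0 \<le> x i"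
    and "0 \<le> y" "y ^ card J = (\<Prod>i\<in>J. x i)"
  shows "y \<le> (\<Sum>i\<in>J. x i / card J)"
proof -
  have "0 < card J"
    using assms(1,2) by (simp add: card_gt_0_iff)
  then have "(y ^ card J) powr (1 / card J) = y"
    using \<open>0 \<le> y\<close>
    by (cases "y = 0") (simp_all add: powr_powr flip: powr_realpow)
  then show ?thesis
    using arith_geom_mean[OF assms(1,2), of x] assms(3,5) by simp
qed

text \<open>Divided by the right-hand side, the two terms on the left are geometric means of the
  ratios \<open>p i ^ k / P i\<close> and \<open>b * q i ^ k / P i\<close>. Arithmetic means bound
  them, and for each \<open>i\<close> the two ratios add up to 1.\<close>

lemma Hoelder_two_points:
  fixes p q :: "'i \<Rightarrow> real"
  assumes "finite J" "J \<noteq> {}" "0 \<le> b"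
    and p: "\<And>i. i \<in> J \<Longrightarrow> 0 < p i" and q: "\<And>i. i \<in> J \<Longrightarrow> 0 \<le> q i"
  shows "(\<Prod>i\<in>J. p i) + b * (\<Prod>i\<in>J. q i)
    \<le> (\<Prod>i\<in>J. root (card J) (p i ^ card J + b * q i ^ card J))"
proof -
  define k where "k = card J"
  define P where "P i = p i ^ k + b * q i ^ k" for i
  define R where "R = (\<Prod>i\<in>J. root k (P i))"
  have "0 < k"
    using assms(1,2) by (simp add: k_def card_gt_0_iff)
  have P: "0 < P i" if "i \<in> J" for i
    unfolding P_def using p[OF that] q[OF that] \<open>0 \<le> b\<close> by (intro add_pos_nonneg) auto
  then have "0 < R"
    unfolding R_def using \<open>0 < k\<close> by (intro prod_pos) simp
  have R: "R ^ k = (\<Prod>i\<in>J. P i)"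
    unfolding R_def prod_power_distrib
    by (intro prod.cong refl) (use P \<open>0 < k\<close> in \<open>simp add: real_root_pow_pos2 less_imp_le\<close>)
  have "(\<Prod>i\<in>J. p i) / R \<le> (\<Sum>i\<in>J. p i ^ k / P i / k)"
    unfolding k_def
  proof (rule geom_le_arith_mean)
    show "((\<Prod>i\<in>J. p i) / R) ^ card J = (\<Prod>i\<in>J. p i ^ card J / P i)"
      using R by (simp add: k_def power_divide prod_dividef prod_power_distrib)
    show "0 \<le> (\<Prod>i\<in>J. p i) / R"
      using \<open>0 < R\<close> p by (intro divide_nonneg_pos prod_nonneg) (auto intro: less_imp_le)
    show "0 \<le> p i ^ card J / P i" if "i \<in> J" for i
      using P[OF that] p[OF that] by (simp add: less_imp_le)
  qed (use assms in auto)
  moreover have "b * (\<Prod>i\<in>J. q i) / R \<le> (\<Sum>i\<in>J. b * q i ^ k / P i / k)"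
    unfolding k_def
  proof (rule geom_le_arith_mean)
    \<comment> \<open>The power \<open>card J\<close> of the single \<open>b\<close> supplies one
      factor \<open>b\<close> per index.\<close>
    show "(b * (\<Prod>i\<in>J. q i) / R) ^ card J = (\<Prod>i\<in>J. b * q i ^ card J / P i)"
      using R
      by (simp add: k_def power_divide power_mult_distrib prod_dividef prod_power_distrib prod.distrib)
    show "0 \<le> b * (\<Prod>i\<in>J. q i) / R"
      using \<open>0 < R\<close> \<open>0 \<le> b\<close> q by (auto intro!: divide_nonneg_pos mult_nonneg_nonneg prod_nonneg)
    show "0 \<le> b * q i ^ card J / P i" if "i \<in> J" for i
      using P[OF that] q[OF that] \<open>0 \<le> b\<close> by (simp add: less_imp_le)
  qed (use assms in auto)
  ultimately have "((\<Prod>i\<in>J. p i) + b * (\<Prod>i\<in>J. q i)) / R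
      \<le> (\<Sum>i\<in>J. p i ^ k / P i / k + b * q i ^ k / P i / k)"
    by (simp add: add_divide_distrib sum.distrib)
  also have "\<dots> = (\<Sum>i\<in>J. 1 / k)"
  proof (intro sum.cong refl)
    fix i assume "i \<in> J"
    then show "p i ^ k / P i / k + b * q i ^ k / P i / k = 1 / k"
      using P[of i] by (simp add: P_def flip: add_divide_distrib)
  qed
  also have "\<dots> = 1"
    using \<open>0 < k\<close> by (simp add: k_def)
  finally show ?thesis
    using \<open>0 < R\<close> by (simp add: R_def P_def k_def)
qed

section \<open>Finner's inequality by summing out one coordinate at a time\<close>

text \<open>Fubini for the coordinate \<open>v\<close>: the sets come in pairs \<open>B\<close>,
  \<open>insert v B\<close>, and the second carries one more factor \<open>b\<close>.\<close>

lemma sum_Pow_insert_weighted: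
  fixes b :: "'r :: comm_semiring_1"
  assumes "finite V" "v \<notin> V"
  shows "(\<Sum>B\<in>Pow (insert v V). b ^ card B * g B)
    = (\<Sum>B\<in>Pow V. b ^ card B * (g B + b * g (insert v B)))"
proof -
  have "inj_on (insert v) (Pow V)"
    using assms(2) by (intro inj_onI) (metis PowD insert_ident subsetD)
  moreover have "Pow V \<inter> insert v ` Pow V = {}"
    using assms(2) by blast
  moreover have "b ^ card (insert v B) = b * b ^ card B" if "B \<in> Pow V" for B
    using assms that by (subst card_insert_disjoint) (auto intro: finite_subset)
  ultimately have "(\<Sum>B\<in>Pow (insert v V). b ^ card B * g B)
      = (\<Sum>B\<in>Pow V. b ^ card B * g B) + (\<Sum>B\<in>Pow V. b * b ^ card B * g (insert v B))"
    using assms(1) by (simp add: Pow_insert sum.union_disjoint sum.reindex)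
  then show ?thesis
    by (simp add: sum.distrib algebra_simps)
qed

text \<open>
  Finner's generalized Hoelder inequality on a product of two-point spaces: the points of the
  product are the subsets of \<open>V\<close>, and the \<open>i\<close>-th function depends on the coordinates in \<open>N i\<close> only.
\<close>

lemma Finner_inequality:
  fixes f :: "'i \<Rightarrow> 'a set \<Rightarrow> real"
  assumes "finite V" "finite I" "0 < k" "0 \<le> b"
    and "\<And>v. v \<in> V \<Longrightarrow> card {i \<in> I. v \<in> N i} = k"
    and "\<And>i. i \<in> I \<Longrightarrow> N i \<subseteq> V"
    and "\<And>i B. i \<in> I \<Longrightarrow> 0 < f i B"
  shows "(\<Sum>B\<in>Pow V. b ^ card B * (\<Prod>i\<in>I. f i (B \<inter> N i)))
    \<le> (\<Prod>i\<in>I. root k (\<Sum>B\<in>Pow (N i). b ^ card B * f i B ^ k))"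
  using assms(1,5-7)
proof (induction V arbitrary: N f rule: finite_induct)
  case empty
  have "root k (\<Sum>B\<in>Pow (N i). b ^ card B * f i B ^ k) = f i {}" if "i \<in> I" for i
    using empty(2)[OF that] empty(3)[OF that, of "{}"] \<open>0 < k\<close>
    by (simp add: real_root_power_cancel less_imp_le)
  then show ?case
    by simp
next
  case (insert v V)
  \<comment> \<open>\<open>J\<close> indexes the functions that depend on the coordinate
    \<open>v\<close>. Summing out \<open>v\<close> replaces each of them by its norm of exponent
    \<open>k\<close> in that coordinate; the others stay as they are.\<close>
  define J where "J = {i \<in> I. v \<in> N i}"
  define N' where "N' i = N i - {v}" for i
  define f' where
    "f' i B = (if i \<in> J then root k (f i B ^ k + b * f i (insert v B) ^ k) else f i B)" for i B
  have J: "J \<subseteq> I" "finite J" "card J = k"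
    using insert.prems(1)[of v] \<open>finite I\<close> by (auto simp: J_def)
  then have "J \<noteq> {}"
    using \<open>0 < k\<close> by auto
  have f: "0 < f i B" if "i \<in> I" for i B
    using insert.prems(3) that by blast
  have ff: "0 < f i B ^ k + b * f i (insert v B) ^ k" if "i \<in> I" for i B
    using f[OF that] \<open>0 \<le> b\<close> by (intro add_pos_nonneg) (auto simp: less_imp_le)
  have f': "0 < f' i B" if "i \<in> I" for i B
    using f[OF that] ff[OF that] \<open>0 < k\<close> by (simp add: f'_def)
  have N': "N' i \<subseteq> V" if "i \<in> I" for i
    using insert.prems(2)[OF that] by (auto simp: N'_def)
  have card_N': "card {i \<in> I. u \<in> N' i} = k" if "u \<in> V" for u
  proof -
    have "{i \<in> I. u \<in> N' i} = {i \<in> I. u \<in> N i}"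
      using that insert.hyps(2) by (auto simp: N'_def)
    then show ?thesis
      using insert.prems(1)[of u] that by simp
  qed
  have split_I: "(\<Prod>i\<in>I. g i) = (\<Prod>i\<in>J. g i) * (\<Prod>i\<in>I - J. g i)" for g :: "'i \<Rightarrow> real"
    using J(1) \<open>finite I\<close> by (simp add: prod.subset_diff mult.commute)
  have step: "(\<Prod>i\<in>I. f i (B \<inter> N i)) + b * (\<Prod>i\<in>I. f i (insert v B \<inter> N i))
      \<le> (\<Prod>i\<in>I. f' i (B \<inter> N' i))" if "B \<in> Pow V" for B
  proof -
    have "v \<notin> B"
      using that insert.hyps(2) by auto
    then have eqs: "B \<inter> N i = B \<inter> N' i" for i
      by (auto simp: N'_def)
    \<comment> \<open>Functions outside \<open>J\<close> do not see \<open>v\<close>, so they are a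
      common factor of both terms. Exactly \<open>k\<close> functions remain, which fits the
      exponent of Hoelder's inequality.\<close>
    have out: "insert v B \<inter> N i = B \<inter> N' i" if "i \<in> I - J" for i
      using that \<open>v \<notin> B\<close> by (auto simp: N'_def J_def)
    have inn: "insert v B \<inter> N i = insert v (B \<inter> N' i)" if "i \<in> J" for i
      using that \<open>v \<notin> B\<close> by (auto simp: N'_def J_def)
    have "(\<Prod>i\<in>I. f i (B \<inter> N i)) + b * (\<Prod>i\<in>I. f i (insert v B \<inter> N i))
      = ((\<Prod>i\<in>J. f i (B \<inter> N' i)) + b * (\<Prod>i\<in>J. f i (insert v (B \<inter> N' i))))
        * (\<Prod>i\<in>I - J. f i (B \<inter> N' i))"
      unfolding split_I eqs distrib_right by (simp add: out inn mult.assoc cong: prod.cong_simp)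
    also have "\<dots> \<le> (\<Prod>i\<in>J. root k (f i (B \<inter> N' i) ^ k + b * f i (insert v (B \<inter> N' i)) ^ k))
        * (\<Prod>i\<in>I - J. f i (B \<inter> N' i))"
      unfolding J(3)[symmetric] using f J \<open>J \<noteq> {}\<close> \<open>0 \<le> b\<close>
      by (intro mult_right_mono Hoelder_two_points prod_nonneg) (auto intro: less_imp_le)
    also have "\<dots> = (\<Prod>i\<in>I. f' i (B \<inter> N' i))"
      by (simp add: split_I f'_def cong: prod.cong_simp)
    finally show ?thesis .
  qed
  \<comment> \<open>The norm over all of \<open>N i\<close> does not change: the power
    \<open>k\<close> undoes the root in \<open>f'\<close>, and the pairs \<open>B\<close>,
    \<open>insert v B\<close> reassemble. Hence the bound from the induction hypothesis is already
    the required one.\<close>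
  have factor: "(\<Sum>B\<in>Pow (N' i). b ^ card B * f' i B ^ k) = (\<Sum>B\<in>Pow (N i). b ^ card B * f i B ^ k)"
    if "i \<in> I" for i
  proof (cases "i \<in> J")
    case True
    have "finite (N' i)"
      using N'[OF that] insert.hyps(1) by (rule finite_subset)
    moreover have "N i = insert v (N' i)" "v \<notin> N' i"
      using True by (auto simp: N'_def J_def)
    moreover have "f' i B ^ k = f i B ^ k + b * f i (insert v B) ^ k" for B
      using True ff[OF that, of B] \<open>0 < k\<close> by (simp add: f'_def real_root_pow_pos2 less_imp_le)
    ultimately show ?thesis
      by (simp add: sum_Pow_insert_weighted)
  next
    case False
    then have "N' i = N i"
      using that by (auto simp: N'_def J_def)
    with False show ?thesis
      by (simp add: f'_def)
  qed
  have "(\<Sum>B\<in>Pow (insert v V). b ^ card B * (\<Prod>i\<in>I. f i (B \<inter> N i)))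
      \<le> (\<Sum>B\<in>Pow V. b ^ card B * (\<Prod>i\<in>I. f' i (B \<inter> N' i)))"
    unfolding sum_Pow_insert_weighted[OF insert.hyps(1,2)]
    using step \<open>0 \<le> b\<close> by (intro sum_mono mult_left_mono) auto
  also have "\<dots> \<le> (\<Prod>i\<in>I. root k (\<Sum>B\<in>Pow (N' i). b ^ card B * f' i B ^ k))"
    by (rule insert.IH) (use card_N' N' f' in auto)
  also have "\<dots> = (\<Prod>i\<in>I. root k (\<Sum>B\<in>Pow (N i). b ^ card B * f i B ^ k))"
    by (simp add: factor cong: prod.cong)
  finally show ?case .
qed

section \<open>Closed neighbourhoods\<close>

definition closed_nbhd :: "('a, 'b) pre_digraph \<Rightarrow> 'a \<Rightarrow> 'a set" where
  "closed_nbhd G u = insert u {v. (u, v) \<in> arcs_ends G}"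

context graph
begin

lemma closed_nbhd_sym: "v \<in> closed_nbhd G u \<longleftrightarrow> u \<in> closed_nbhd G v"
  using arcs_ends_symmetric[OF sym_arcs] by (auto simp: closed_nbhd_def)

lemma closed_nbhd_subset: "u \<in> verts G \<Longrightarrow> closed_nbhd G u \<subseteq> verts G"
  by (auto simp: closed_nbhd_def dest: adj_in_verts)

text \<open>Without parallel arcs, neighbours correspond to outgoing arcs; without loops,
  \<open>u\<close> itself adds one more.\<close>

lemma card_closed_nbhd: "card (closed_nbhd G u) = Suc (out_degree G u)"
proof -
  have "{v. (u, v) \<in> arcs_ends G} = head G ` out_arcs G u"
    by (auto simp: arcs_ends_conv)
  moreover have "inj_on (head G) (out_arcs G u)"
    by (intro inj_onI no_multi_arcs) (auto simp: arc_to_ends_def)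
  moreover have "u \<notin> {v. (u, v) \<in> arcs_ends G}"
    using adj_not_same by blast
  ultimately show ?thesis
    using finite_out_arcs[of u] by (simp add: closed_nbhd_def out_degree_def card_image)
qed

end

section \<open>The Widom-Rowlinson partition function as a sum over blue sets\<close>

lemma arcs_ends_WR_graph:
  "(x, y) \<in> arcs_ends WR_graph \<longleftrightarrow> (x, y) \<noteq> (Red, Blue) \<and> (x, y) \<noteq> (Blue, Red)"
  by (cases x; cases y) (auto simp: WR_graph_def arcs_ends_conv)

lemma verts_WR_graph: "verts WR_graph = UNIV"
  using wr_vertex.exhaust by (auto simp: WR_graph_def)

instance wr_vertex :: finite
proof
  have "(UNIV :: wr_vertex set) = {Red, White, Blue}"
    using wr_vertex.exhaust by auto
  then show "finite (UNIV :: wr_vertex set)"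
    by (metis finite.simps)
qed

lemma (in graph) partition_function_WR_graph:
  assumes "lw \<noteq> 0"
  shows "partition_function G WR_graph (WR_weight lr lw lb) =
    lw ^ card (verts G) * (\<Sum>B\<in>Pow (verts G). (lb / lw) ^ card B *
      (\<Prod>u\<in>verts G. if B \<inter> closed_nbhd G u = {} then 1 + lr / lw else 1))"
proof -
  let ?V = "verts G"
  let ?\<mu> = "WR_weight lr lw lb"
  let ?\<Phi> = "?V \<rightarrow>\<^sub>E (UNIV :: wr_vertex set)"
  define valid where "valid \<phi> \<longleftrightarrow> (\<forall>(u, v)\<in>arcs_ends G. (\<phi> u, \<phi> v) \<in> arcs_ends WR_graph)" for \<phi>
  define blue where "blue \<phi> = {u \<in> ?V. \<phi> u = Blue}" for \<phi>
  \<comment> \<open>The colours left for \<open>u\<close> once the blue set is \<open>B\<close>.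
    They do not depend on the colours chosen elsewhere, so each fibre of \<open>blue\<close> is a
    product set.\<close>
  define S where "S B u = (if u \<in> B then {Blue}
    else if B \<inter> closed_nbhd G u = {} then {Red, White} else {White})" for B u
  have finite_arcs_ends: "finite (arcs_ends G)"
    by (simp add: arcs_ends_def)
  have finite_\<Phi>: "finite ?\<Phi>"
    by (intro finite_PiE) auto
  have indicators: "(\<Prod>(u, v)\<in>arcs_ends G. indicator (arcs_ends WR_graph) (\<phi> u, \<phi> v))
      = (if valid \<phi> then 1 else (0 :: real))" for \<phi>
    using finite_arcs_ends unfolding valid_def
    by (auto simp: case_prod_beta indicator_def intro!: prod.neutral)
  have fibre: "{\<phi> \<in> ?\<Phi>. valid \<phi> \<and> blue \<phi> = B} = PiE ?V (S B)" if "B \<subseteq> ?V" for B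
  proof (intro equalityI subsetI)
    fix \<phi> assume "\<phi> \<in> {\<phi> \<in> ?\<Phi>. valid \<phi> \<and> blue \<phi> = B}"
    then have \<phi>: "\<phi> \<in> ?\<Phi>" "valid \<phi>" "B = blue \<phi>"
      by auto
    show "\<phi> \<in> PiE ?V (S B)"
    proof (rule PiE_I)
      fix u assume u: "u \<in> ?V"
      have "\<phi> u \<noteq> Red" if "v \<in> blue \<phi>" "v \<in> closed_nbhd G u" for v
        using that \<phi>(2) by (fastforce simp: blue_def closed_nbhd_def valid_def arcs_ends_WR_graph)
      then show "\<phi> u \<in> S B u"
        using u unfolding \<phi>(3) by (cases "\<phi> u") (auto simp: S_def blue_def)
    qed (use \<phi>(1) in auto)
  next
    fix \<phi> assume \<phi>: "\<phi> \<in> PiE ?V (S B)"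
    have blue: "\<phi> u = Blue \<longleftrightarrow> u \<in> B" if "u \<in> ?V" for u
      using PiE_mem[OF \<phi> that] by (auto simp: S_def split: if_splits)
    have red: "B \<inter> closed_nbhd G u = {}" if "u \<in> ?V" "\<phi> u = Red" for u
      using PiE_mem[OF \<phi> that(1)] that(2) by (auto simp: S_def split: if_splits)
    \<comment> \<open>Only a red-blue pair could fail, and the closed neighbourhood of its red end
      would contain the blue end, an element of \<open>B\<close>.\<close>
    have "(\<phi> u, \<phi> v) \<in> arcs_ends WR_graph" if uv: "(u, v) \<in> arcs_ends G" for u v
    proof -
      have V: "u \<in> ?V" "v \<in> ?V" and N: "v \<in> closed_nbhd G u" "u \<in> closed_nbhd G v"
        using uv adj_in_verts[OF uv] closed_nbhd_sym by (auto simp: closed_nbhd_def)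
      show ?thesis
        using blue[OF V(1)] blue[OF V(2)] red[OF V(1)] red[OF V(2)] N
        by (auto simp: arcs_ends_WR_graph)
    qed
    then show "\<phi> \<in> {\<phi> \<in> ?\<Phi>. valid \<phi> \<and> blue \<phi> = B}"
      using \<phi> blue that by (auto simp: valid_def blue_def)
  qed
  have fibre_sum: "(\<Sum>\<phi>\<in>PiE ?V (S B). \<Prod>u\<in>?V. ?\<mu> (\<phi> u))
      = lw ^ card ?V * ((lb / lw) ^ card B *
        (\<Prod>u\<in>?V. if B \<inter> closed_nbhd G u = {} then 1 + lr / lw else 1))" if "B \<subseteq> ?V" for B
  proof -
    have "(\<Sum>\<phi>\<in>PiE ?V (S B). \<Prod>u\<in>?V. ?\<mu> (\<phi> u)) = (\<Prod>u\<in>?V. \<Sum>x\<in>S B u. ?\<mu> x)"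
      by (subst prod_sum_PiE) (auto simp: S_def)
    \<comment> \<open>The local sums are \<open>lb\<close>, \<open>lr + lw\<close> and
      \<open>lw\<close>. A vertex of \<open>B\<close> lies in its own closed neighbourhood, so its
      last factor is 1.\<close>
    also have "\<dots> = (\<Prod>u\<in>?V. lw * ((if u \<in> B then lb / lw else 1) *
        (if B \<inter> closed_nbhd G u = {} then 1 + lr / lw else 1)))"
      using assms by (intro prod.cong refl) (auto simp: S_def closed_nbhd_def algebra_simps)
    also have "\<dots> = lw ^ card ?V * ((\<Prod>u\<in>?V. if u \<in> B then lb / lw else 1) *
        (\<Prod>u\<in>?V. if B \<inter> closed_nbhd G u = {} then 1 + lr / lw else 1))"
      by (simp only: prod.distrib prod_constant)
    also have "(\<Prod>u\<in>?V. if u \<in> B then lb / lw else 1) = (lb / lw) ^ card B"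
      using that by (simp add: prod.If_cases Int_absorb1)
    finally show ?thesis .
  qed
  have "partition_function G WR_graph ?\<mu> = (\<Sum>\<phi>\<in>{\<phi> \<in> ?\<Phi>. valid \<phi>}. \<Prod>u\<in>?V. ?\<mu> (\<phi> u))"
    unfolding partition_function_def verts_WR_graph indicators
    using finite_\<Phi> by (intro sum.mono_neutral_cong_right) auto
  also have "\<dots> = (\<Sum>B\<in>Pow ?V. \<Sum>\<phi>\<in>{\<phi> \<in> {\<phi> \<in> ?\<Phi>. valid \<phi>}. blue \<phi> = B}. \<Prod>u\<in>?V. ?\<mu> (\<phi> u))"
    by (rule sum.group[symmetric]) (use finite_\<Phi> in \<open>auto simp: blue_def\<close>)
  also have "\<dots> = (\<Sum>B\<in>Pow ?V. \<Sum>\<phi>\<in>PiE ?V (S B). \<Prod>u\<in>?V. ?\<mu> (\<phi> u))"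
    using fibre by (intro sum.cong refl) (auto simp: conj_assoc)
  also have "\<dots> = (\<Sum>B\<in>Pow ?V. lw ^ card ?V * ((lb / lw) ^ card B *
      (\<Prod>u\<in>?V. if B \<inter> closed_nbhd G u = {} then 1 + lr / lw else 1)))"
    using fibre_sum by (intro sum.cong refl) simp
  finally show ?thesis
    by (simp add: sum_distrib_left)
qed

section \<open>Comparison with the complete graph\<close>

text \<open>A bijection of the ground sets induces one of the power sets that preserves sizes. This
  carries sums from a neighbourhood in \<open>G\<close> to the vertices of \<open>K\<close>, whose
  type differs.\<close>

lemma sum_Pow_card_cong:
  fixes F :: "nat \<Rightarrow> 'r :: comm_monoid_add"
  assumes "finite A" "finite A'" "card A = card A'"
  shows "(\<Sum>B\<in>Pow A. F (card B)) = (\<Sum>B\<in>Pow A'. F (card B))"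
proof -
  obtain h where h: "bij_betw h A A'"
    using finite_same_card_bij[OF assms] by blast
  have "(\<Sum>B\<in>Pow A. F (card (h ` B))) = (\<Sum>B\<in>Pow A'. F (card B))"
    by (rule sum.reindex_bij_betw[OF bij_betw_Pow[OF h]])
  moreover have "card (h ` B) = card B" if "B \<in> Pow A" for B
    using h that by (intro card_image) (auto simp: bij_betw_def intro: inj_on_subset)
  ultimately show ?thesis
    by simp
qed

theorem theorem5:
  fixes G :: "('a, 'b) pre_digraph" and K :: "('c, 'e) pre_digraph"
    and d n :: nat and lr lw lb :: real
  assumes "lr > 0" and "lw > 0" and "lb > 0"
    and "d \<ge> 1"
    and "regular_graph d G" and "card (verts G) = n"
    and "complete_digraph (d + 1) K"
  shows "partition_function G WR_graph (WR_weight lr lw lb)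
    \<le> partition_function K WR_graph (WR_weight lr lw lb) powr (real n / real (d + 1))"
proof -
  interpret G: graph G
    using assms(5) by (simp add: regular_graph_def)
  interpret K: graph K
    using assms(7) by (simp add: complete_digraph_def)
  define k where "k = d + 1"
  define b where "b = lb / lw"
  define h where "h B = (if B = {} then 1 + lr / lw else 1)" for B :: "'a set"
  \<comment> \<open>The exponent \<open>k\<close> has two roles: in \<open>K\<close> it counts the
    vertices, whose factors all coincide, and in \<open>G\<close> it is the exponent in Finner's
    inequality. Hence \<open>T\<close> serves both sides.\<close>
  define s where "s j = b ^ j * (if j = 0 then 1 + lr / lw else 1) ^ k" for j
  define T where "T = (\<Sum>B\<in>Pow (verts K). s (card B))"
  have pos: "0 < lw" "0 \<le> b" "0 < 1 + lr / lw"
    using assms(1-3) by (auto simp: b_def intro: add_pos_pos)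
  have card_K: "card (verts K) = k"
    using assms(7) by (simp add: complete_digraph_def k_def)
  have nbhd_K: "closed_nbhd K u = verts K" if "u \<in> verts K" for u
    using assms(7) that by (auto simp: closed_nbhd_def complete_digraph_def)
  have card_G: "card (closed_nbhd G u) = k" if "u \<in> verts G" for u
    using assms(5) that by (simp add: G.card_closed_nbhd regular_graph_def k_def)
  \<comment> \<open>By symmetry, the neighbourhoods containing \<open>v\<close> are those of the
    members of its own, so regularity gives a uniform cover.\<close>
  have "{i \<in> verts G. v \<in> closed_nbhd G i} = closed_nbhd G v" if "v \<in> verts G" for v
    using G.closed_nbhd_subset[OF that] G.closed_nbhd_sym by blast
  then have cover: "card {i \<in> verts G. v \<in> closed_nbhd G i} = k" if "v \<in> verts G" for v
    using card_G that by simp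
  have "partition_function K WR_graph (WR_weight lr lw lb) = lw ^ k * (\<Sum>B\<in>Pow (verts K).
      b ^ card B * (\<Prod>u\<in>verts K. if B \<inter> closed_nbhd K u = {} then 1 + lr / lw else 1))"
    using pos by (simp add: K.partition_function_WR_graph card_K b_def)
  also have "\<dots> = lw ^ k * T"
    unfolding T_def
  proof (intro arg_cong2[where f = "(*)"] sum.cong refl)
    fix B assume "B \<in> Pow (verts K)"
    then have "finite B" "B \<inter> verts K = B"
      using finite_subset[OF _ K.finite_verts] by auto
    then have "B \<inter> closed_nbhd K u = {} \<longleftrightarrow> card B = 0" if "u \<in> verts K" for u
      using that by (simp add: nbhd_K)
    then show "b ^ card B * (\<Prod>u\<in>verts K. if B \<inter> closed_nbhd K u = {} then 1 + lr / lw else 1)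
        = s (card B)"
      by (simp add: s_def card_K)
  qed
  finally have Z_K: "partition_function K WR_graph (WR_weight lr lw lb) = lw ^ k * T" .
  have "0 < s 0"
    using pos by (simp add: s_def)
  moreover have "0 \<le> s j" for j
    using pos by (simp add: s_def)
  ultimately have "0 < T"
    unfolding T_def by (intro sum_pos2[where i = "{}"]) auto
  \<comment> \<open>Each vertex is both a coordinate (blue or not) and the index of a
    function.\<close>
  have "(\<Sum>B\<in>Pow (verts G). b ^ card B * (\<Prod>u\<in>verts G. h (B \<inter> closed_nbhd G u)))
      \<le> (\<Prod>u\<in>verts G. root k (\<Sum>B\<in>Pow (closed_nbhd G u). b ^ card B * h B ^ k))"
    using cover G.closed_nbhd_subset pos by (intro Finner_inequality) (auto simp: k_def h_def)
  also have "\<dots> = (\<Prod>u\<in>verts G. root k T)"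
  proof (intro prod.cong refl arg_cong[where f = "root k"])
    fix u assume u: "u \<in> verts G"
    \<comment> \<open>Finiteness makes \<open>card B = 0\<close> mean that \<open>B\<close> is
      empty.\<close>
    have fin: "finite (closed_nbhd G u)"
      using G.closed_nbhd_subset[OF u] by (rule finite_subset) simp
    then have "b ^ card B * h B ^ k = s (card B)" if "B \<in> Pow (closed_nbhd G u)" for B
      using that finite_subset[of B] by (auto simp: h_def s_def)
    then have "(\<Sum>B\<in>Pow (closed_nbhd G u). b ^ card B * h B ^ k)
        = (\<Sum>B\<in>Pow (closed_nbhd G u). s (card B))"
      by (intro sum.cong) auto
    also have "\<dots> = T"
      unfolding T_def using fin by (intro sum_Pow_card_cong) (simp_all add: card_G[OF u] card_K)
    finally show "(\<Sum>B\<in>Pow (closed_nbhd G u). b ^ card B * h B ^ k) = T" .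
  qed
  also have "\<dots> = root k T ^ n"
    by (simp add: assms(6))
  finally have "lw ^ n * (\<Sum>B\<in>Pow (verts G). b ^ card B * (\<Prod>u\<in>verts G. h (B \<inter> closed_nbhd G u)))
      \<le> lw ^ n * root k T ^ n"
    using pos by simp
  then have "partition_function G WR_graph (WR_weight lr lw lb) \<le> lw ^ n * root k T ^ n"
    using pos by (simp add: G.partition_function_WR_graph assms(6) b_def h_def)
  \<comment> \<open>Each factor \<open>lw\<close> enters the root as \<open>lw ^ k\<close>, which
    completes \<open>T\<close> to the partition function of \<open>K\<close>.\<close>
  also have "lw ^ n * root k T ^ n = root k (lw ^ k * T) ^ n"
    using pos by (simp add: real_root_mult real_root_power_cancel k_def power_mult_distrib
        del: power_Suc)
  also have "\<dots> = (lw ^ k * T) powr (real n / real k)"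
    using pos \<open>0 < T\<close>
    by (simp add: root_powr_inverse k_def powr_powr del: power_Suc flip: powr_realpow)
  finally show ?thesis
    by (simp add: Z_K k_def)
qed

end
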